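(* Let $\Gamma$ be a cancelation monoid with neutral element $e$, and let $A=\bigoplus_{\gamma\in\Gamma}A_\gamma$ be a $\Gamma$-graded ring. Then $A_e$, the degree-$e$ part of $A$, is a local ring if and only if the graded two-sided ideal $\mathfrak{M}$ of $A$ generated by all non-invertible homogeneous elements of $A$ is a proper ideal.
   Context: Rings are associative with identity $1$, not necessarily commutative. A cancelation monoid $\Gamma$ is a (not necessarily commutative) monoid with neutral element $e$ in which $\gamma\gamma_1=\gamma\gamma_2$ implies $\gamma_1=\gamma_2$ and $\gamma_1\gamma=\gamma_2\gamma$ implies $\gamma_1=\gamma_2$. A $\Gamma$-graded ring is a ring $A$ with a decomposition $A=\bigoplus_{\gamma\in\Gamma}A_\gamma$ into additive subgroups such that $A_{\gamma_1}A_{\gamma_2}\subseteq A_{\gamma_1\gamma_2}$ for all $\gamma_1,\gamma_2\in\Gamma$; $A_e$ is a subring containing $1$. A homogeneous element of degree $\gamma$ is a nonzero element of $A_\gamma$. A (left, right, two-sided) ideal is graded if it is generated by homogeneous elements. A local ring (in the classical sense) is a ring with a unique maximal left ideal, which is also its unique maximal right ideal and its unique maximal two-sided ideal. *)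

theory Defs
  imports "HOL-Algebra.Divisibility" "HOL-Algebra.Ideal"
begin

locale graded_ring = \<Gamma>: monoid \<Gamma> + ring R
  for \<Gamma> :: "('g, 'm) monoid_scheme" and R :: "('a, 'n) ring_scheme" (structure) +
  fixes A :: "'g \<Rightarrow> 'a set"
  assumes component_subgroup: "\<gamma> \<in> carrier \<Gamma> \<Longrightarrow> additive_subgroup (A \<gamma>) R"
    (* internal direct sum: unique decomposition into a finitely supported family of components;
       membership in PiE pins the family down outside carrier \<Gamma> *)
    and direct_sum: "x \<in> carrier R \<Longrightarrow>
      \<exists>!f. f \<in> (\<Pi>\<^sub>E \<gamma>\<in>carrier \<Gamma>. A \<gamma>) \<and> finite {\<gamma> \<in> carrier \<Gamma>. f \<gamma> \<noteq> \<zero>} \<and>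
           x = (\<Oplus>\<gamma>\<in>{\<gamma> \<in> carrier \<Gamma>. f \<gamma> \<noteq> \<zero>}. f \<gamma>)"
    and component_mult: "\<lbrakk>\<gamma>1 \<in> carrier \<Gamma>; \<gamma>2 \<in> carrier \<Gamma>; x \<in> A \<gamma>1; y \<in> A \<gamma>2\<rbrakk>
      \<Longrightarrow> x \<otimes> y \<in> A (\<gamma>1 \<otimes>\<^bsub>\<Gamma>\<^esub> \<gamma>2)"

definition homogeneous ::
  "('g, 'm) monoid_scheme \<Rightarrow> ('a, 'n) ring_scheme \<Rightarrow> ('g \<Rightarrow> 'a set) \<Rightarrow> 'a \<Rightarrow> bool"
  where "homogeneous \<Gamma> R A x \<longleftrightarrow> x \<noteq> \<zero>\<^bsub>R\<^esub> \<and> (\<exists>\<gamma>\<in>carrier \<Gamma>. x \<in> A \<gamma>)"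

locale left_ideal = additive_subgroup I R + ring R for I and R (structure) +
  assumes l_closed: "\<lbrakk>a \<in> I; x \<in> carrier R\<rbrakk> \<Longrightarrow> x \<otimes> a \<in> I"

locale right_ideal = additive_subgroup I R + ring R for I and R (structure) +
  assumes r_closed: "\<lbrakk>a \<in> I; x \<in> carrier R\<rbrakk> \<Longrightarrow> a \<otimes> x \<in> I"

locale maximal_left_ideal = left_ideal +
  assumes notcarr: "carrier R \<noteq> I"
    and maximal: "\<lbrakk>left_ideal J R; I \<subseteq> J; J \<subseteq> carrier R\<rbrakk> \<Longrightarrow> J = I \<or> J = carrier R"

locale maximal_right_ideal = right_ideal +
  assumes notcarr: "carrier R \<noteq> I"
    and maximal: "\<lbrakk>right_ideal J R; I \<subseteq> J; J \<subseteq> carrier R\<rbrakk> \<Longrightarrow> J = I \<or> J = carrier R"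

(* maximalideal and ideal are two-sided in HOL-Algebra. *)
locale local_ring = ring +
  assumes unique_maximal: "\<exists>M. (\<forall>I. maximal_left_ideal I R \<longleftrightarrow> I = M) \<and>
    (\<forall>I. maximal_right_ideal I R \<longleftrightarrow> I = M) \<and> (\<forall>I. maximalideal I R \<longleftrightarrow> I = M)"

(* Units R refers to two-sided invertibility in the whole ring R. *)
definition noninv_homogeneous_ideal ::
  "('g, 'm) monoid_scheme \<Rightarrow> ('a, 'n) ring_scheme \<Rightarrow> ('g \<Rightarrow> 'a set) \<Rightarrow> 'a set"
  where "noninv_homogeneous_ideal \<Gamma> R A = Idl\<^bsub>R\<^esub> {x. homogeneous \<Gamma> R A x \<and> x \<notin> Units R}"

end

theory Submission
  imports Defs "HOL-Algebra.Subrings"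
begin

text \<open>
  The non-units of a local ring form a two-sided ideal, and conversely; moreover the units of
  \<open>A\<^sub>e\<close> are the units of \<open>A\<close> lying in \<open>A\<^sub>e\<close>. If \<open>\<MM>\<close> is proper, the non-units of \<open>A\<^sub>e\<close> are
  therefore \<open>A\<^sub>e \<inter> \<MM>\<close>, an ideal. Conversely, if \<open>A\<^sub>e\<close> is local and \<open>1 \<in> \<MM>\<close>, then taking
  components of degree \<open>e\<close> gives a unit \<open>axb\<close> of \<open>A\<^sub>e\<close> with \<open>a\<close>, \<open>x\<close>, \<open>b\<close> homogeneous and \<open>x\<close>
  not invertible; normalise to \<open>axb = 1\<close>. Cancellation in \<open>\<Gamma>\<close> puts \<open>xba\<close> and \<open>bax\<close> in \<open>A\<^sub>e\<close>,
  where they are nonzero idempotents, hence equal to \<open>1\<close>, so \<open>x\<close> is invertible after all.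
\<close>

section \<open>Local rings and non-units\<close>

lemma (in ring) left_ideal_one_imp_carrier:
  assumes "left_ideal I R" "\<one> \<in> I"
  shows "I = carrier R"
proof -
  interpret left_ideal I R by fact
  show ?thesis using l_closed[OF assms(2)] a_subset by force
qed

lemma (in ring) right_ideal_one_imp_carrier:
  assumes "right_ideal I R" "\<one> \<in> I"
  shows "I = carrier R"
proof -
  interpret right_ideal I R by fact
  show ?thesis using r_closed[OF assms(2)] a_subset by force
qed

lemma (in ring) left_ideal_Units_imp_carrier:
  assumes "left_ideal I R" "u \<in> I" "u \<in> Units R"
  shows "I = carrier R"
proof (rule left_ideal_one_imp_carrier)
  interpret left_ideal I R by fact
  show "\<one> \<in> I" using l_closed[OF assms(2) Units_inv_closed[OF assms(3)]] assms(3) by simp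
qed fact

lemma (in ring) right_ideal_Units_imp_carrier:
  assumes "right_ideal I R" "u \<in> I" "u \<in> Units R"
  shows "I = carrier R"
proof (rule right_ideal_one_imp_carrier)
  interpret right_ideal I R by fact
  show "\<one> \<in> I" using r_closed[OF assms(2) Units_inv_closed[OF assms(3)]] assms(3) by simp
qed fact

text \<open>Negation is multiplication by \<open>\<ominus> \<one>\<close>, so additive inverses
  follow from the \<open>mult\<close> assumption.\<close>

lemma (in ring) left_idealI:
  assumes "I \<subseteq> carrier R" "\<zero> \<in> I"
    and add: "\<And>a b. \<lbrakk>a \<in> I; b \<in> I\<rbrakk> \<Longrightarrow> a \<oplus> b \<in> I"
    and mult: "\<And>a x. \<lbrakk>a \<in> I; x \<in> carrier R\<rbrakk> \<Longrightarrow> x \<otimes> a \<in> I"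
  shows "left_ideal I R"
proof -
  have "\<ominus> a \<in> I" if "a \<in> I" for a
  proof -
    have "\<ominus> a = (\<ominus> \<one>) \<otimes> a" using that assms(1) by (auto simp: l_minus)
    then show ?thesis using mult[OF that] by simp
  qed
  then have "subgroup I (add_monoid R)"
    using assms by (auto intro!: add.subgroupI simp: a_inv_def)
  then show ?thesis
    by (intro left_ideal.intro additive_subgroup.intro left_ideal_axioms.intro mult ring_axioms)
qed

lemma (in ring) left_ideal_in_maximal_left_ideal:
  assumes I: "left_ideal I R" and proper: "I \<noteq> carrier R"
  obtains M where "maximal_left_ideal M R" "I \<subseteq> M"
proof -
  \<comment> \<open>Properness is expressed as avoiding \<open>\<one>\<close>, a condition that
    visibly survives unions of chains, as Zorn's lemma requires.\<close>
  define P where "P = {J. left_ideal J R \<and> \<one> \<notin> J \<and> I \<subseteq> J}"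
  have "\<exists>M\<in>P. \<forall>X\<in>P. M \<subseteq> X \<longrightarrow> X = M"
  proof (rule subset_Zorn_nonempty)
    show "P \<noteq> {}" using I proper left_ideal_one_imp_carrier unfolding P_def by blast
  next
    fix C assume ne: "C \<noteq> {}" and chain: "subset.chain P C"
    have CP: "\<And>J. J \<in> C \<Longrightarrow> left_ideal J R \<and> \<one> \<notin> J \<and> I \<subseteq> J"
      using chain unfolding subset.chain_def P_def by auto
    then have sub: "\<And>J. J \<in> C \<Longrightarrow> additive_subgroup J R"
      using left_ideal.axioms(1) by blast
    have "left_ideal (\<Union>C) R"
    proof (rule left_idealI)
      show "\<Union>C \<subseteq> carrier R"
        using additive_subgroup.a_subset[OF sub] by blast
      show "\<zero> \<in> \<Union>C"
        using ne additive_subgroup.zero_closed[OF sub] by blast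
    next
      fix a b assume "a \<in> \<Union>C" "b \<in> \<Union>C"
      then obtain J K where "J \<in> C" "a \<in> J" "K \<in> C" "b \<in> K" by blast
      moreover have "J \<subseteq> K \<or> K \<subseteq> J"
        using chain \<open>J \<in> C\<close> \<open>K \<in> C\<close> unfolding subset.chain_def by blast
      ultimately obtain L where "L \<in> C" "a \<in> L" "b \<in> L" by blast
      then show "a \<oplus> b \<in> \<Union>C"
        using additive_subgroup.a_closed[OF sub] by blast
    next
      fix a x assume "a \<in> \<Union>C" and x: "x \<in> carrier R"
      then obtain J where J: "J \<in> C" "a \<in> J" by blast
      then have "x \<otimes> a \<in> J" using left_ideal.l_closed[of J R a x] CP x by blast
      then show "x \<otimes> a \<in> \<Union>C" using J by blast
    qed
    moreover have "\<one> \<notin> \<Union>C" "I \<subseteq> \<Union>C" using CP ne by auto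
    ultimately show "\<Union>C \<in> P" unfolding P_def by simp
  qed
  then obtain M where "M \<in> P" and max: "\<forall>X\<in>P. M \<subseteq> X \<longrightarrow> X = M"
    by (elim bexE)
  then have M: "left_ideal M R" "\<one> \<notin> M" "I \<subseteq> M"
    unfolding P_def by simp_all
  have "maximal_left_ideal M R"
  proof (intro maximal_left_ideal.intro maximal_left_ideal_axioms.intro)
    show "carrier R \<noteq> M" using M(2) one_closed by blast
    fix J assume J: "left_ideal J R" "M \<subseteq> J"
    then have "J \<in> P" if "\<one> \<notin> J"
      using that M(3) unfolding P_def by simp
    then show "J = M \<or> J = carrier R"
      using max J left_ideal_one_imp_carrier[of J] by blast
  qed fact
  then show thesis using M(3) that by blast
qed

text \<open>The unique maximal ideal \<open>M\<close> turns out to be the set of non-units. Elements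
  outside \<open>M\<close> have left inverses, and these again lie outside \<open>M\<close>, which
  makes them two-sided; conversely a proper ideal contains no unit.\<close>

lemma (in local_ring) nonunits_ideal: "ideal (carrier R - Units R) R"
proof -
  obtain M where left: "\<And>I. maximal_left_ideal I R \<longleftrightarrow> I = M"
    and two: "\<And>I. maximalideal I R \<longleftrightarrow> I = M"
    using unique_maximal by blast
  interpret M: maximalideal M R using two by blast
  have one: "\<one> \<notin> M" using M.I_notcarr M.one_imp_carrier by blast
  have left_inverse: "\<exists>y\<in>carrier R. y \<otimes> x = \<one>" if x: "x \<in> carrier R" "x \<notin> M" for x
  proof -
    \<comment> \<open>The principal left ideal of \<open>x\<close>: if it were proper, it would lie
      in a maximal left ideal, that is in \<open>M\<close>, although it contains
      \<open>x\<close>.\<close>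
    let ?I = "(\<lambda>y. y \<otimes> x) ` carrier R"
    have I: "left_ideal ?I R"
    proof (rule left_idealI)
      show "?I \<subseteq> carrier R" using x by auto
      show "\<zero> \<in> ?I" using x by (auto intro!: image_eqI[of _ _ \<zero>])
    next
      fix a b assume "a \<in> ?I" "b \<in> ?I"
      then show "a \<oplus> b \<in> ?I"
        using x by (auto simp: l_distr[symmetric])
    next
      fix a z assume "a \<in> ?I" "z \<in> carrier R"
      then show "z \<otimes> a \<in> ?I"
        using x by (auto simp: m_assoc[symmetric])
    qed
    have "x \<in> ?I" using x by (auto intro!: image_eqI[of _ _ \<one>])
    then have "?I = carrier R"
      using left_ideal_in_maximal_left_ideal[OF I] left x by blast
    then show ?thesis using one_closed by (metis (no_types, lifting) imageE)
  qed
  have "x \<in> Units R" if x: "x \<in> carrier R" "x \<notin> M" for x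
  proof -
    obtain y where y: "y \<in> carrier R" "y \<otimes> x = \<one>" using left_inverse[OF x] by blast
    have "y \<notin> M" using M.I_r_closed[of y x] x y one by auto
    then obtain z where z: "z \<in> carrier R" "z \<otimes> y = \<one>" using left_inverse y by blast
    \<comment> \<open>Here \<open>z = z(yx) = (zy)x = x\<close>, so \<open>y\<close> is also a right
      inverse of \<open>x\<close>.\<close>
    have "z = x" using x y z by (metis l_one m_assoc r_one)
    then show ?thesis using x y z unfolding Units_def by blast
  qed
  moreover have "x \<notin> Units R" if "x \<in> M" for x
    using M.I_l_closed[OF that Units_inv_closed[of x]] one Units_l_inv by auto
  ultimately have "M = carrier R - Units R" using M.a_subset by blast
  then show ?thesis using M.is_ideal by simp
qed

text \<open>A proper one-sided ideal contains no unit, so it lies in the set of non-units. Being an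
  ideal itself, that set is the largest proper left, right and two-sided ideal
  simultaneously.\<close>

lemma (in ring) local_ringI:
  assumes ideal: "ideal (carrier R - Units R) R"
  shows "local_ring R"
proof -
  let ?N = "carrier R - Units R"
  interpret N: ideal ?N R by fact
  have sub: "additive_subgroup ?N R" by (rule N.additive_subgroup_axioms)
  have left: "left_ideal ?N R"
    by (intro left_ideal.intro left_ideal_axioms.intro sub ring_axioms N.I_l_closed)
  have right: "right_ideal ?N R"
    by (intro right_ideal.intro right_ideal_axioms.intro sub ring_axioms N.I_r_closed)
  have proper: "carrier R \<noteq> ?N" using Units_one_closed one_closed by blast
  \<comment> \<open>Viewing two-sided ideals as left ideals lets \<open>below_left\<close> bound
    them as well.\<close>
  have ideal_left: "left_ideal J R" if "ideal J R" for J
    using that by (intro left_ideal.intro left_ideal_axioms.intro ring_axioms)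
      (auto simp: ideal_def ideal.I_l_closed[OF that])
  have below_left: "J \<subseteq> ?N" if "left_ideal J R" "J \<noteq> carrier R" for J
    using that left_ideal_Units_imp_carrier[OF that(1)]
      additive_subgroup.a_subset[OF left_ideal.axioms(1)[OF that(1)]]
    by blast
  have below_right: "J \<subseteq> ?N" if "right_ideal J R" "J \<noteq> carrier R" for J
    using that right_ideal_Units_imp_carrier[OF that(1)]
      additive_subgroup.a_subset[OF right_ideal.axioms(1)[OF that(1)]]
    by blast
  have "maximal_left_ideal I R \<longleftrightarrow> I = ?N" for I
  proof
    assume "maximal_left_ideal I R"
    then interpret I: maximal_left_ideal I R .
    show "I = ?N"
      using I.maximal[OF left] below_left[OF I.left_ideal_axioms] I.notcarr proper by blast
  next
    show "maximal_left_ideal I R" if "I = ?N"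
      unfolding that
    proof (intro maximal_left_ideal.intro maximal_left_ideal_axioms.intro left proper)
      show "J = ?N \<or> J = carrier R" if "left_ideal J R" "?N \<subseteq> J" for J
        using below_left[OF that(1)] that(2) by blast
    qed
  qed
  moreover have "maximal_right_ideal I R \<longleftrightarrow> I = ?N" for I
  proof
    assume "maximal_right_ideal I R"
    then interpret I: maximal_right_ideal I R .
    show "I = ?N"
      using I.maximal[OF right] below_right[OF I.right_ideal_axioms] I.notcarr proper by blast
  next
    show "maximal_right_ideal I R" if "I = ?N"
      unfolding that
    proof (intro maximal_right_ideal.intro maximal_right_ideal_axioms.intro right proper)
      show "J = ?N \<or> J = carrier R" if "right_ideal J R" "?N \<subseteq> J" for J
        using below_right[OF that(1)] that(2) by blast
    qed
  qed
  moreover have "maximalideal I R \<longleftrightarrow> I = ?N" for I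
  proof
    assume "maximalideal I R"
    then interpret I: maximalideal I R .
    show "I = ?N"
      using I.I_maximal[OF ideal] below_left[OF ideal_left[OF I.is_ideal]] I.I_notcarr proper
      by blast
  next
    show "maximalideal I R" if "I = ?N"
      unfolding that
    proof (intro maximalidealI ideal proper)
      show "J = ?N \<or> J = carrier R" if "ideal J R" "?N \<subseteq> J" for J
        using below_left[OF ideal_left[OF that(1)]] that(2) by blast
    qed
  qed
  ultimately show ?thesis
    by (intro local_ring.intro local_ring_axioms.intro ring_axioms) blast
qed

text \<open>Since \<open>x\<close> and \<open>1 - x\<close> add up to a unit, they are not both
  non-units. Their product is zero, so whichever is a unit can be cancelled.\<close>

lemma (in local_ring) idempotent_trivial:
  assumes x: "x \<in> carrier R" and idem: "x \<otimes> x = x"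
  shows "x = \<zero> \<or> x = \<one>"
proof -
  interpret N: ideal "carrier R - Units R" R by (rule nonunits_ideal)
  have 0: "x \<otimes> (\<one> \<ominus> x) = \<zero>"
    using x idem by (simp add: minus_eq r_distr r_minus r_neg)
  have "x \<oplus> (\<one> \<ominus> x) = \<one>"
    using x by (simp add: minus_eq a_comm[of \<one>] r_neg2)
  then have "x \<in> Units R \<or> \<one> \<ominus> x \<in> Units R"
    using N.a_closed[of x "\<one> \<ominus> x"] x by auto
  then show ?thesis
  proof
    assume u: "x \<in> Units R"
    have "x = inv x \<otimes> (x \<otimes> x)" using u by (simp add: m_assoc[symmetric] x)
    then show ?thesis using idem u by simp
  next
    assume u: "\<one> \<ominus> x \<in> Units R"
    have "x = x \<otimes> (\<one> \<ominus> x) \<otimes> inv (\<one> \<ominus> x)" using u x by (simp add: m_assoc)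
    then show ?thesis using 0 u by simp
  qed
qed

section \<open>Homogeneous components\<close>

context graded_ring
begin

text \<open>Copies the formula under the unique existence quantifier of \<open>direct_sum\<close>,
  so that this axiom can be folded into it.\<close>

definition decomposition :: "('g \<Rightarrow> 'a) \<Rightarrow> 'a \<Rightarrow> bool"
  where "decomposition f x \<longleftrightarrow> f \<in> (\<Pi>\<^sub>E \<gamma>\<in>carrier \<Gamma>. A \<gamma>) \<and>
    finite {\<gamma> \<in> carrier \<Gamma>. f \<gamma> \<noteq> \<zero>} \<and> x = (\<Oplus>\<gamma>\<in>{\<gamma> \<in> carrier \<Gamma>. f \<gamma> \<noteq> \<zero>}. f \<gamma>)"

text \<open>The homogeneous component of degree \<open>\<gamma>\<close>. For \<open>x\<close> in
  \<open>carrier R\<close> the description is well defined by \<open>direct_sum\<close>.\<close>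

definition proj :: "'g \<Rightarrow> 'a \<Rightarrow> 'a"
  where "proj \<gamma> x = (THE f. decomposition f x) \<gamma>"

lemma component_closed: "\<lbrakk>\<gamma> \<in> carrier \<Gamma>; x \<in> A \<gamma>\<rbrakk> \<Longrightarrow> x \<in> carrier R"
  using additive_subgroup.a_subset[OF component_subgroup] by blast

lemma zero_component: "\<gamma> \<in> carrier \<Gamma> \<Longrightarrow> \<zero> \<in> A \<gamma>"
  by (rule additive_subgroup.zero_closed[OF component_subgroup])

lemma add_component: "\<lbrakk>\<gamma> \<in> carrier \<Gamma>; x \<in> A \<gamma>; y \<in> A \<gamma>\<rbrakk> \<Longrightarrow> x \<oplus> y \<in> A \<gamma>"
  by (rule additive_subgroup.a_closed[OF component_subgroup])

lemma decomposition_proj: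
  assumes "x \<in> carrier R" shows "decomposition (\<lambda>\<gamma>. proj \<gamma> x) x"
  using theI'[OF direct_sum[OF assms, folded decomposition_def]] by (simp add: proj_def)

lemma proj_eqI:
  assumes "decomposition f x" "x \<in> carrier R" shows "proj \<gamma> x = f \<gamma>"
  unfolding proj_def
  using the1_equality[OF direct_sum[OF assms(2), folded decomposition_def], OF assms(1)] by simp

text \<open>Zero summands do not change the sum, so any finite set containing the support may index
  it. This spares computing exact supports later.\<close>

lemma decompositionI:
  assumes f: "f \<in> (\<Pi>\<^sub>E \<gamma>\<in>carrier \<Gamma>. A \<gamma>)" and F: "finite F" "F \<subseteq> carrier \<Gamma>"
    and zero: "\<And>\<gamma>. \<lbrakk>\<gamma> \<in> carrier \<Gamma>; \<gamma> \<notin> F\<rbrakk> \<Longrightarrow> f \<gamma> = \<zero>"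
  shows "decomposition f (\<Oplus>\<gamma>\<in>F. f \<gamma>)"
proof -
  let ?S = "{\<gamma> \<in> carrier \<Gamma>. f \<gamma> \<noteq> \<zero>}"
  have S: "?S \<subseteq> F" using zero by blast
  have "(\<Oplus>\<gamma>\<in>?S. f \<gamma>) = (\<Oplus>\<gamma>\<in>F. f \<gamma>)"
    using f F S component_closed
    by (intro add.finprod_mono_neutral_cong_left) (auto simp: PiE_iff)
  then show ?thesis
    using f finite_subset[OF S F(1)] unfolding decomposition_def by simp
qed

lemma proj_component:
  assumes "x \<in> carrier R" "\<gamma> \<in> carrier \<Gamma>" shows "proj \<gamma> x \<in> A \<gamma>"
  using decomposition_proj[OF assms(1)] assms(2) unfolding decomposition_def by auto

lemma proj_closed: "\<lbrakk>x \<in> carrier R; \<gamma> \<in> carrier \<Gamma>\<rbrakk> \<Longrightarrow> proj \<gamma> x \<in> carrier R"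
  by (rule component_closed[OF _ proj_component])

lemma proj_homogeneous:
  assumes x: "\<gamma> \<in> carrier \<Gamma>" "x \<in> A \<gamma>" and \<delta>: "\<delta> \<in> carrier \<Gamma>"
  shows "proj \<delta> x = (if \<delta> = \<gamma> then x else \<zero>)"
proof -
  \<comment> \<open>The restriction makes \<open>f\<close> extensional, as membership in the
    \<open>PiE\<close> set demands.\<close>
  define f where "f = restrict (\<lambda>\<delta>. if \<delta> = \<gamma> then x else \<zero>) (carrier \<Gamma>)"
  have "decomposition f (\<Oplus>\<delta>\<in>{\<gamma>}. f \<delta>)"
    using x zero_component by (intro decompositionI) (auto simp: f_def)
  moreover have "(\<Oplus>\<delta>\<in>{\<gamma>}. f \<delta>) = x"
    using x component_closed by (simp add: f_def)
  ultimately show ?thesis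
    using proj_eqI[of f x \<delta>] x \<delta> component_closed by (simp add: f_def)
qed

lemma proj_component_id: "\<lbrakk>\<gamma> \<in> carrier \<Gamma>; x \<in> A \<gamma>\<rbrakk> \<Longrightarrow> proj \<gamma> x = x"
  by (simp add: proj_homogeneous)

text \<open>Both decompositions are summed over the union of the two supports. Components may cancel
  there, so this union can exceed the support of the sum.\<close>

lemma proj_add:
  assumes x: "x \<in> carrier R" and y: "y \<in> carrier R" and \<gamma>: "\<gamma> \<in> carrier \<Gamma>"
  shows "proj \<gamma> (x \<oplus> y) = proj \<gamma> x \<oplus> proj \<gamma> y"
proof -
  let ?S = "\<lambda>z. {\<gamma> \<in> carrier \<Gamma>. proj \<gamma> z \<noteq> \<zero>}"
  let ?F = "?S x \<union> ?S y"
  define f where "f = restrict (\<lambda>\<gamma>. proj \<gamma> x \<oplus> proj \<gamma> y) (carrier \<Gamma>)"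
  have fin: "finite ?F"
    using decomposition_proj[OF x] decomposition_proj[OF y] unfolding decomposition_def by simp
  have sum: "(\<Oplus>\<gamma>\<in>?F. proj \<gamma> z) = z" if z: "z \<in> carrier R" "?S z \<subseteq> ?F" for z
  proof -
    have "(\<Oplus>\<gamma>\<in>?S z. proj \<gamma> z) = (\<Oplus>\<gamma>\<in>?F. proj \<gamma> z)"
      using z fin proj_closed by (intro add.finprod_mono_neutral_cong_left) auto
    then show ?thesis using decomposition_proj[OF z(1)] unfolding decomposition_def by simp
  qed
  have "decomposition f (\<Oplus>\<gamma>\<in>?F. f \<gamma>)"
    using fin x y proj_component add_component by (intro decompositionI) (auto simp: f_def)
  moreover have "(\<Oplus>\<gamma>\<in>?F. f \<gamma>) = (\<Oplus>\<gamma>\<in>?F. proj \<gamma> x \<oplus> proj \<gamma> y)"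
    using x y proj_closed by (intro finsum_cong') (auto simp: f_def)
  moreover have "\<dots> = (\<Oplus>\<gamma>\<in>?F. proj \<gamma> x) \<oplus> (\<Oplus>\<gamma>\<in>?F. proj \<gamma> y)"
    using x y proj_closed by (intro finsum_addf) auto
  moreover have "\<dots> = x \<oplus> y" using sum[of x] sum[of y] x y by simp
  ultimately show ?thesis
    using proj_eqI[of f "x \<oplus> y" \<gamma>] x y \<gamma> by (simp add: f_def)
qed

text \<open>Every element is the finite sum of its components. The case \<open>homogeneous\<close>
  includes zero, which provides the empty sum.\<close>

lemma homogeneous_induct [consumes 1, case_names homogeneous add]:
  assumes x: "x \<in> carrier R"
    and hom: "\<And>\<gamma> x. \<lbrakk>\<gamma> \<in> carrier \<Gamma>; x \<in> A \<gamma>\<rbrakk> \<Longrightarrow> P x"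
    and add: "\<And>x y. \<lbrakk>x \<in> carrier R; y \<in> carrier R; P x; P y\<rbrakk> \<Longrightarrow> P (x \<oplus> y)"
  shows "P x"
proof -
  have zero: "P \<zero>" using hom[OF \<Gamma>.one_closed zero_component[OF \<Gamma>.one_closed]] .
  have "P (\<Oplus>\<gamma>\<in>F. proj \<gamma> x)" if "finite F" "F \<subseteq> carrier \<Gamma>" for F
    using that
  proof (induction F rule: finite_induct)
    case (insert \<gamma> F)
    have cl: "(\<lambda>\<gamma>. proj \<gamma> x) \<in> F \<rightarrow> carrier R" using insert.prems x proj_closed by auto
    show ?case
      using insert cl x proj_closed proj_component hom[of \<gamma> "proj \<gamma> x"]
      by (simp add: add)
  qed (simp add: zero)
  then show ?thesis
    using decomposition_proj[OF x] unfolding decomposition_def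
    by (metis (mono_tags, lifting) mem_Collect_eq subsetI)
qed

end

section \<open>Gradings by cancellation monoids\<close>

locale cancel_graded_ring = graded_ring \<Gamma> R A + \<Gamma>: monoid_cancel \<Gamma>
  for \<Gamma> :: "('g, 'm) monoid_scheme" and R :: "('a, 'n) ring_scheme" (structure) and A
begin

abbreviation degree_one :: "('a, 'n) ring_scheme"
  where "degree_one \<equiv> R\<lparr>carrier := A \<one>\<^bsub>\<Gamma>\<^esub>\<rparr>"

text \<open>By left cancellation, \<alpha>\<gamma> = \<alpha> only for neutral \<gamma>, so only the
  degree-e component of \<open>s\<close> contributes in degree \<alpha>.\<close>

lemma proj_mult_homogeneous:
  assumes x: "\<alpha> \<in> carrier \<Gamma>" "x \<in> A \<alpha>" and s: "s \<in> carrier R"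
  shows "proj \<alpha> (x \<otimes> s) = x \<otimes> proj \<one>\<^bsub>\<Gamma>\<^esub> s"
  using s
proof (induction s rule: homogeneous_induct)
  case (homogeneous \<gamma> s)
  have "\<alpha> = \<alpha> \<otimes>\<^bsub>\<Gamma>\<^esub> \<gamma> \<longleftrightarrow> \<one>\<^bsub>\<Gamma>\<^esub> = \<gamma>"
    using \<Gamma>.l_cancel[of \<alpha> "\<one>\<^bsub>\<Gamma>\<^esub>" \<gamma>] x homogeneous by auto
  then show ?case
    using x homogeneous component_closed component_mult
    by (simp add: proj_homogeneous[where \<gamma> = "\<alpha> \<otimes>\<^bsub>\<Gamma>\<^esub> \<gamma>"] proj_homogeneous[where \<gamma> = \<gamma>])
next
  case (add s t)
  then show ?case
    using x component_closed by (simp add: r_distr proj_add proj_closed)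
qed

section \<open>The subring of degree e and its units\<close>

text \<open>The degree-e component \<open>?u\<close> of \<open>\<one>\<close> is a right identity:
  for homogeneous \<open>x\<close>, comparing components in \<open>x \<otimes> \<one> = x\<close>
  gives \<open>x \<otimes> ?u = x\<close>, and additivity does the rest. Taking
  \<open>x = \<one>\<close> yields \<open>?u = \<one>\<close>.\<close>

lemma one_component: "\<one> \<in> A \<one>\<^bsub>\<Gamma>\<^esub>"
proof -
  let ?u = "proj \<one>\<^bsub>\<Gamma>\<^esub> \<one>"
  have u: "?u \<in> carrier R" by (simp add: proj_closed)
  have "x \<otimes> ?u = x" if "x \<in> carrier R" for x
    using that
  proof (induction x rule: homogeneous_induct)
    case (homogeneous \<gamma> x)
    then show ?case
      using proj_mult_homogeneous[of \<gamma> x \<one>] component_closed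
      by (simp add: proj_homogeneous)
  next
    case (add x y)
    then show ?case using u by (simp add: l_distr)
  qed
  from this[of \<one>] have "?u = \<one>" using u by simp
  then show ?thesis using proj_component[of \<one> "\<one>\<^bsub>\<Gamma>\<^esub>"] by simp
qed

lemma degree_one_ring: "ring degree_one"
proof (rule subring_is_ring, rule subringI)
  show "A \<one>\<^bsub>\<Gamma>\<^esub> \<subseteq> carrier R" using component_closed by auto
  show "\<ominus> h \<in> A \<one>\<^bsub>\<Gamma>\<^esub>" if "h \<in> A \<one>\<^bsub>\<Gamma>\<^esub>" for h
    using additive_subgroup.a_inv_closed[OF component_subgroup[OF \<Gamma>.one_closed]] ring_axioms that
    by blast
  show "h \<otimes> k \<in> A \<one>\<^bsub>\<Gamma>\<^esub>" if "h \<in> A \<one>\<^bsub>\<Gamma>\<^esub>" "k \<in> A \<one>\<^bsub>\<Gamma>\<^esub>" for h k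
    using component_mult[OF \<Gamma>.one_closed \<Gamma>.one_closed that] by simp
qed (simp_all add: one_component add_component)

text \<open>The point is that inverses stay in degree e: taking degree-e components in
  \<open>x \<otimes> inv x = \<one>\<close> shows that the component of \<open>inv x\<close> is
  already a right inverse of \<open>x\<close>, hence equal to \<open>inv x\<close>.\<close>

lemma Units_degree_one: "Units degree_one = A \<one>\<^bsub>\<Gamma>\<^esub> \<inter> Units R"
proof
  show "Units degree_one \<subseteq> A \<one>\<^bsub>\<Gamma>\<^esub> \<inter> Units R"
    using component_closed[OF \<Gamma>.one_closed] unfolding Units_def by auto
  show "A \<one>\<^bsub>\<Gamma>\<^esub> \<inter> Units R \<subseteq> Units degree_one"
  proof
    fix x assume "x \<in> A \<one>\<^bsub>\<Gamma>\<^esub> \<inter> Units R"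
    then have x: "x \<in> A \<one>\<^bsub>\<Gamma>\<^esub>" "x \<in> Units R" by auto
    let ?y = "proj \<one>\<^bsub>\<Gamma>\<^esub> (inv x)"
    have y: "?y \<in> A \<one>\<^bsub>\<Gamma>\<^esub>" "?y \<in> carrier R"
      using x by (simp_all add: proj_component proj_closed)
    have xy: "x \<otimes> ?y = \<one>"
      using proj_mult_homogeneous[of "\<one>\<^bsub>\<Gamma>\<^esub>" x "inv x"] x one_component
      by (simp add: proj_component_id)
    then have "?y = inv x"
      using x y by (metis Units_closed Units_inv_closed Units_l_inv l_one m_assoc r_one)
    then have "?y \<otimes> x = \<one>" using x by simp
    then show "x \<in> Units degree_one" using x y xy unfolding Units_def by auto
  qed
qed

section \<open>From a local degree-e part to a proper ideal\<close>

text \<open>The candidate inverse of \<open>x\<close> is \<open>b \<otimes> a\<close>. Its products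
  with \<open>x\<close> on either side are idempotents of degree e, and locality leaves only zero
  and one for them.\<close>

lemma homogeneous_factor_of_one_is_unit:
  assumes loc: "local_ring degree_one"
    and deg: "\<alpha> \<in> carrier \<Gamma>" "\<xi> \<in> carrier \<Gamma>" "\<beta> \<in> carrier \<Gamma>"
    and a: "a \<in> A \<alpha>" and x: "x \<in> A \<xi>" and b: "b \<in> A \<beta>"
    and deg_one: "\<alpha> \<otimes>\<^bsub>\<Gamma>\<^esub> (\<xi> \<otimes>\<^bsub>\<Gamma>\<^esub> \<beta>) = \<one>\<^bsub>\<Gamma>\<^esub>" and one: "a \<otimes> (x \<otimes> b) = \<one>"
  shows "x \<in> Units R"
proof -
  interpret E: local_ring degree_one by fact
  have cl: "a \<in> carrier R" "x \<in> carrier R" "b \<in> carrier R"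
    using a x b deg component_closed by auto
  \<comment> \<open>From \<gamma>\<delta> = e follows \<gamma>(\<delta>\<gamma>) =
    (\<gamma>\<delta>)\<gamma> = \<gamma>e; then \<gamma> is cancelled on the left. One-sided
    inverses in \<Gamma> are thus two-sided.\<close>
  have swap: "\<delta> \<otimes>\<^bsub>\<Gamma>\<^esub> \<gamma> = \<one>\<^bsub>\<Gamma>\<^esub>"
    if "\<gamma> \<in> carrier \<Gamma>" "\<delta> \<in> carrier \<Gamma>" "\<gamma> \<otimes>\<^bsub>\<Gamma>\<^esub> \<delta> = \<one>\<^bsub>\<Gamma>\<^esub>" for \<gamma> \<delta>
    using that \<Gamma>.l_cancel[of \<gamma> "\<delta> \<otimes>\<^bsub>\<Gamma>\<^esub> \<gamma>" "\<one>\<^bsub>\<Gamma>\<^esub>"]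
    by (simp add: \<Gamma>.m_assoc[symmetric])
  have deg1: "\<xi> \<otimes>\<^bsub>\<Gamma>\<^esub> (\<beta> \<otimes>\<^bsub>\<Gamma>\<^esub> \<alpha>) = \<one>\<^bsub>\<Gamma>\<^esub>"
    using swap[of \<alpha> "\<xi> \<otimes>\<^bsub>\<Gamma>\<^esub> \<beta>"] deg deg_one by (simp add: \<Gamma>.m_assoc)
  then have deg2: "(\<beta> \<otimes>\<^bsub>\<Gamma>\<^esub> \<alpha>) \<otimes>\<^bsub>\<Gamma>\<^esub> \<xi> = \<one>\<^bsub>\<Gamma>\<^esub>"
    using swap[of \<xi> "\<beta> \<otimes>\<^bsub>\<Gamma>\<^esub> \<alpha>"] deg by simp
  have ba: "b \<otimes> a \<in> A (\<beta> \<otimes>\<^bsub>\<Gamma>\<^esub> \<alpha>)" using a b deg component_mult by blast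
  define p q where "p = x \<otimes> (b \<otimes> a)" and "q = (b \<otimes> a) \<otimes> x"
  have p: "p \<in> A \<one>\<^bsub>\<Gamma>\<^esub>" and q: "q \<in> A \<one>\<^bsub>\<Gamma>\<^esub>"
    using component_mult[OF _ _ x ba] component_mult[OF _ _ ba x] deg deg1 deg2
    by (simp_all add: p_def q_def)
  have pc: "p \<in> carrier R" and qc: "q \<in> carrier R"
    using p q component_closed by auto
  have "p \<otimes> p = x \<otimes> (b \<otimes> ((a \<otimes> (x \<otimes> b)) \<otimes> a))"
    using cl by (simp add: p_def m_assoc)
  then have pp: "p \<otimes> p = p" using cl one by (simp add: p_def)
  have "q \<otimes> q = b \<otimes> ((a \<otimes> (x \<otimes> b)) \<otimes> (a \<otimes> x))"
    using cl by (simp add: q_def m_assoc)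
  then have qq: "q \<otimes> q = q" using cl one by (simp add: q_def m_assoc)
  \<comment> \<open>Inserting \<open>p\<close>, and later \<open>q\<close>, into the product
    \<open>axb\<close> still gives \<open>\<one>\<close>. If either were zero, this would force
    \<open>\<zero> = \<one>\<close>, so both idempotents equal \<open>\<one>\<close> in any
    case.\<close>
  have "a \<otimes> (p \<otimes> (x \<otimes> b)) = (a \<otimes> (x \<otimes> b)) \<otimes> (a \<otimes> (x \<otimes> b))"
    using cl by (simp add: p_def m_assoc)
  then have ap: "a \<otimes> (p \<otimes> (x \<otimes> b)) = \<one>" using one by simp
  have "a \<otimes> (x \<otimes> (q \<otimes> b)) = (a \<otimes> (x \<otimes> b)) \<otimes> (a \<otimes> (x \<otimes> b))"
    using cl by (simp add: q_def m_assoc)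
  then have aq: "a \<otimes> (x \<otimes> (q \<otimes> b)) = \<one>" using one by simp
  have "p = \<one>" using E.idempotent_trivial[of p] p pp ap cl by auto
  moreover have "q = \<one>" using E.idempotent_trivial[of q] q qq aq cl by auto
  ultimately show ?thesis using cl unfolding Units_def p_def q_def by blast
qed

text \<open>Non-units of the local ring are closed under addition, so induction on \<open>a\<close>
  and then on \<open>b\<close> reduces to homogeneous multipliers. Products of other degrees project
  to zero, itself a non-unit; in degree e a unit would make \<open>x\<close> invertible.\<close>

lemma noninv_proj_nonunit:
  assumes loc: "local_ring degree_one"
    and x: "\<xi> \<in> carrier \<Gamma>" "x \<in> A \<xi>" "x \<notin> Units R"
    and a: "a \<in> carrier R" and b: "b \<in> carrier R"
  shows "proj \<one>\<^bsub>\<Gamma>\<^esub> (a \<otimes> (x \<otimes> b)) \<in> A \<one>\<^bsub>\<Gamma>\<^esub> - Units R" (is "_ \<in> ?N")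
proof -
  interpret E: local_ring degree_one by fact
  have N_eq: "carrier degree_one - Units degree_one = ?N"
    by (auto simp: Units_degree_one)
  interpret N: ideal ?N degree_one using E.nonunits_ideal N_eq by simp
  have N_add: "\<And>u v. \<lbrakk>u \<in> ?N; v \<in> ?N\<rbrakk> \<Longrightarrow> u \<oplus> v \<in> ?N" using N.a_closed by simp
  have xc: "x \<in> carrier R" using x component_closed by auto
  show ?thesis using a
  proof (induction a rule: homogeneous_induct)
    case (homogeneous \<alpha> a)
    have ac: "a \<in> carrier R" using homogeneous component_closed by auto
    show ?case using b
    proof (induction b rule: homogeneous_induct)
      case b: (homogeneous \<beta> b)
      have bc: "b \<in> carrier R" using b component_closed by auto
      let ?u = "a \<otimes> (x \<otimes> b)" and ?\<delta> = "\<alpha> \<otimes>\<^bsub>\<Gamma>\<^esub> (\<xi> \<otimes>\<^bsub>\<Gamma>\<^esub> \<beta>)"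
      have u: "?u \<in> A ?\<delta>" and \<delta>: "?\<delta> \<in> carrier \<Gamma>"
        using homogeneous b x component_mult by auto
      show ?case
      proof (cases "?\<delta> = \<one>\<^bsub>\<Gamma>\<^esub>")
        case True
        have "?u \<notin> Units R"
        proof
          assume unit: "?u \<in> Units R"
          then have "?u \<in> Units degree_one" using u True by (simp add: Units_degree_one)
          then obtain v where v: "v \<in> A \<one>\<^bsub>\<Gamma>\<^esub>" "v \<otimes> ?u = \<one>"
            unfolding Units_def by auto
          have vc: "v \<in> carrier R" using v component_closed by auto
          \<comment> \<open>The left inverse \<open>v\<close> of the product has degree e, so
            absorbing it into \<open>a\<close> normalises the product to \<open>\<one>\<close>
            without changing degrees.\<close>
          have "v \<otimes> a \<in> A \<alpha>"
            using component_mult[OF \<Gamma>.one_closed homogeneous(1) v(1) homogeneous(2)]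
              homogeneous(1) by simp
          moreover have "(v \<otimes> a) \<otimes> (x \<otimes> b) = \<one>"
            using v vc ac bc xc by (simp add: m_assoc)
          ultimately have "x \<in> Units R"
            using homogeneous_factor_of_one_is_unit[OF loc homogeneous(1) x(1) b(1)] x(2) b(2) True
            by blast
          then show False using x by simp
        qed
        then show ?thesis using u True by (simp add: proj_component_id)
      next
        case False
        then have "proj \<one>\<^bsub>\<Gamma>\<^esub> ?u = \<zero>"
          using proj_homogeneous[OF \<delta> u, of "\<one>\<^bsub>\<Gamma>\<^esub>"] by auto
        then show ?thesis using N.zero_closed by simp
      qed
    next
      case (add b c)
      have "a \<otimes> (x \<otimes> (b \<oplus> c)) = a \<otimes> (x \<otimes> b) \<oplus> a \<otimes> (x \<otimes> c)"
        using add ac xc by (simp add: r_distr)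
      then show ?case using N_add[OF add.IH] add ac xc by (simp add: proj_add)
    qed
  next
    case (add a c)
    have "(a \<oplus> c) \<otimes> (x \<otimes> b) = a \<otimes> (x \<otimes> b) \<oplus> c \<otimes> (x \<otimes> b)"
      using add b xc by (simp add: l_distr)
    then show ?case using N_add[OF add.IH] add b xc by (simp add: proj_add)
  qed
qed

text \<open>It suffices to find an ideal that contains the generators but not \<open>\<one>\<close>;
  the auxiliary \<open>J\<close> is built from the conclusion of
  \<open>noninv_proj_nonunit\<close>.\<close>

lemma noninv_ideal_proper:
  assumes loc: "local_ring degree_one"
  shows "noninv_homogeneous_ideal \<Gamma> R A \<noteq> carrier R"
proof -
  interpret E: local_ring degree_one by fact
  let ?N = "A \<one>\<^bsub>\<Gamma>\<^esub> - Units R"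
  have N_eq: "carrier degree_one - Units degree_one = ?N"
    by (auto simp: Units_degree_one)
  interpret N: ideal ?N degree_one using E.nonunits_ideal N_eq by simp
  have N_add: "\<And>u v. \<lbrakk>u \<in> ?N; v \<in> ?N\<rbrakk> \<Longrightarrow> u \<oplus> v \<in> ?N" using N.a_closed by simp
  \<comment> \<open>quantifying over all multipliers makes this an ideal without describing the generated
    ideal by finite sums\<close>
  define J where "J = {r \<in> carrier R. \<forall>a\<in>carrier R. \<forall>b\<in>carrier R.
    proj \<one>\<^bsub>\<Gamma>\<^esub> (a \<otimes> (r \<otimes> b)) \<in> ?N}"
  have proj_zero: "proj \<one>\<^bsub>\<Gamma>\<^esub> \<zero> = \<zero>"
    using proj_homogeneous[OF \<Gamma>.one_closed zero_component[OF \<Gamma>.one_closed] \<Gamma>.one_closed] by simp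
  have J_left: "s \<otimes> r \<in> J" if "r \<in> J" "s \<in> carrier R" for r s
  proof -
    have "a \<otimes> ((s \<otimes> r) \<otimes> b) = (a \<otimes> s) \<otimes> (r \<otimes> b)"
      if "a \<in> carrier R" "b \<in> carrier R" for a b
      using that \<open>r \<in> J\<close> \<open>s \<in> carrier R\<close> by (simp add: J_def m_assoc)
    then show ?thesis using that by (simp add: J_def)
  qed
  have J_right: "r \<otimes> s \<in> J" if "r \<in> J" "s \<in> carrier R" for r s
    using that by (simp add: J_def m_assoc)
  have J_add: "r \<oplus> s \<in> J" if "r \<in> J" "s \<in> J" for r s
  proof -
    have "proj \<one>\<^bsub>\<Gamma>\<^esub> (a \<otimes> ((r \<oplus> s) \<otimes> b)) \<in> ?N"
      if "a \<in> carrier R" "b \<in> carrier R" for a b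
    proof -
      have rs: "r \<in> carrier R" "s \<in> carrier R" using \<open>r \<in> J\<close> \<open>s \<in> J\<close> by (simp_all add: J_def)
      then have "proj \<one>\<^bsub>\<Gamma>\<^esub> (a \<otimes> ((r \<oplus> s) \<otimes> b)) =
          proj \<one>\<^bsub>\<Gamma>\<^esub> (a \<otimes> (r \<otimes> b)) \<oplus> proj \<one>\<^bsub>\<Gamma>\<^esub> (a \<otimes> (s \<otimes> b))"
        using that by (simp add: l_distr r_distr proj_add)
      moreover have "proj \<one>\<^bsub>\<Gamma>\<^esub> (a \<otimes> (r \<otimes> b)) \<in> ?N" "proj \<one>\<^bsub>\<Gamma>\<^esub> (a \<otimes> (s \<otimes> b)) \<in> ?N"
        using \<open>r \<in> J\<close> \<open>s \<in> J\<close> that by (simp_all add: J_def)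
      ultimately show ?thesis using N_add by simp
    qed
    then show ?thesis using that by (simp add: J_def)
  qed
  \<comment> \<open>This detour through \<open>left_idealI\<close> supplies the additive subgroup,
    including negation, for the two-sided ideal below.\<close>
  have J_left_ideal: "left_ideal J R"
  proof (rule left_idealI)
    show "J \<subseteq> carrier R" by (auto simp: J_def)
    show "\<zero> \<in> J" using N.zero_closed by (simp add: J_def proj_zero)
  qed (use J_add J_left in auto)
  have "ideal J R"
  proof (rule idealI)
    show "subgroup J (add_monoid R)"
      using J_left_ideal left_ideal.axioms(1) additive_subgroup.a_subgroup by blast
  qed (use ring_axioms J_left J_right in auto)
  moreover have "{x. homogeneous \<Gamma> R A x \<and> x \<notin> Units R} \<subseteq> J"
    using noninv_proj_nonunit[OF loc] component_closed
    unfolding homogeneous_def J_def by blast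
  ultimately have "noninv_homogeneous_ideal \<Gamma> R A \<subseteq> J"
    unfolding noninv_homogeneous_ideal_def by (rule genideal_minimal)
  \<comment> \<open>With both multipliers equal to \<open>\<one>\<close>, membership would make the
    degree-e component of \<open>\<one>\<close>, namely \<open>\<one>\<close> itself, a
    non-unit.\<close>
  moreover have "\<one> \<notin> J"
  proof
    assume "\<one> \<in> J"
    then have "proj \<one>\<^bsub>\<Gamma>\<^esub> (\<one> \<otimes> (\<one> \<otimes> \<one>)) \<in> ?N" unfolding J_def by blast
    then show False using one_component by (simp add: proj_component_id)
  qed
  ultimately show ?thesis by auto
qed

section \<open>From a proper ideal to a local degree-e part\<close>

text \<open>Nonzero non-units of degree e are generators of \<open>M\<close>, and a proper
  \<open>M\<close> contains no unit. Hence the non-units of the degree-e part are its intersection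
  with \<open>M\<close>, an ideal there, and \<open>local_ringI\<close> applies.\<close>

lemma local_if_noninv_ideal_proper:
  assumes proper: "noninv_homogeneous_ideal \<Gamma> R A \<noteq> carrier R"
  shows "local_ring degree_one"
proof -
  interpret E: ring degree_one by (rule degree_one_ring)
  let ?G = "{x. homogeneous \<Gamma> R A x \<and> x \<notin> Units R}"
  define M where "M = Idl ?G"
  have G: "?G \<subseteq> carrier R" by (auto simp: homogeneous_def component_closed)
  interpret M: ideal M R unfolding M_def by (rule genideal_ideal[OF G])
  have one: "\<one> \<notin> M"
    using proper M.one_imp_carrier unfolding noninv_homogeneous_ideal_def M_def by blast
  have "x \<in> M" if "x \<in> A \<one>\<^bsub>\<Gamma>\<^esub>" "x \<notin> Units R" for x
  \<comment> \<open>Zero is not homogeneous, hence not a generator, but it lies in every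
    ideal.\<close>
  proof (cases "x = \<zero>")
    case False
    then have "x \<in> ?G" using that \<Gamma>.one_closed unfolding homogeneous_def by blast
    then show ?thesis using genideal_self[OF G] unfolding M_def by blast
  qed simp
  moreover have "x \<notin> Units R" if "x \<in> M" for x
    using M.I_l_closed[OF that Units_inv_closed[of x]] one Units_l_inv by auto
  ultimately have N_eq: "carrier degree_one - Units degree_one = A \<one>\<^bsub>\<Gamma>\<^esub> \<inter> M"
    by (auto simp: Units_degree_one)
  have mult: "x \<otimes> y \<in> A \<one>\<^bsub>\<Gamma>\<^esub>" if "x \<in> A \<one>\<^bsub>\<Gamma>\<^esub>" "y \<in> A \<one>\<^bsub>\<Gamma>\<^esub>" for x y
    using component_mult[OF \<Gamma>.one_closed \<Gamma>.one_closed that] by simp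
  have N_left: "left_ideal (A \<one>\<^bsub>\<Gamma>\<^esub> \<inter> M) degree_one"
    using component_closed[OF \<Gamma>.one_closed]
    by (intro E.left_idealI)
      (auto simp: zero_component add_component mult M.I_l_closed)
  have "ideal (A \<one>\<^bsub>\<Gamma>\<^esub> \<inter> M) degree_one"
  proof (rule idealI)
    show "subgroup (A \<one>\<^bsub>\<Gamma>\<^esub> \<inter> M) (add_monoid degree_one)"
      using N_left left_ideal.axioms(1) additive_subgroup.a_subgroup by blast
  qed (use component_closed[OF \<Gamma>.one_closed] in
      \<open>auto simp: mult M.I_l_closed M.I_r_closed degree_one_ring\<close>)
  then show ?thesis using E.local_ringI N_eq by simp
qed

end

theorem theorem2p5:
  fixes \<Gamma> :: "('g, 'm) monoid_scheme"
    and R :: "('a, 'n) ring_scheme"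
    and A :: "'g \<Rightarrow> 'a set"
  assumes "monoid_cancel \<Gamma>"
    and "graded_ring \<Gamma> R A"
  shows "local_ring (R\<lparr>carrier := A \<one>\<^bsub>\<Gamma>\<^esub>\<rparr>) \<longleftrightarrow>
    noninv_homogeneous_ideal \<Gamma> R A \<noteq> carrier R"
proof -
  interpret cancel_graded_ring \<Gamma> R A
    using assms by (intro cancel_graded_ring.intro)
  show ?thesis by (rule iffI[OF noninv_ideal_proper local_if_noninv_ideal_proper])
qed

end
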